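(* Let $\mathit{Var}$ be finite, $M$ a commutative complete quantale and $\sigma:\mathit{Var}\to M_1$. Let $\mathrm{ord}(m)$ be the least $k\ge1$ with $m^k=m^{k+1}$. Then for every $\mathbb M\in\mathcal U_{\mathbb N}(\mathit{Var})$, $$\alpha^{\mathbb N}_\sigma(\mathbb M)=\bigvee_{m\in\mathbb M}\bigotimes_v\sigma(v)^{\min(m(v),\,\mathrm{ord}\,\sigma(v))},$$ that is, over-counting a source stops mattering after $\mathrm{ord}$ uses. For $\mathbb S=\mathrm{tc}\{\sim_1,\sim_2\}\in\mathrm{QoI}(D)$, where $D=\{0,1\}^2$ and $\sim_i$ is the kernel of the $i$th projection, one has $\mathbb S^2=\top=\mathbb S^3$, so the order of $\mathbb S$ is two.
   Context: A commutative complete quantale $\langle M,\sqsubseteq,\bigvee,\otimes,1\rangle$ is a complete lattice with a commutative monoid $(\otimes,1)$ such that $\otimes$ distributes over arbitrary joins. $M_1=\{m\mid 1\sqsubseteq m\}$. $m^0=1$ and $m^n$ is the $n$-fold tensor power; $\top$ is the greatest element. $\mathcal U_{\mathbb N}(\mathit{Var})$ is the set of downsets of $(\mathbb N^{\mathit{Var}},\le)$, and $\alpha^{\mathbb N}_\sigma(\mathbb M)=\bigvee_{m\in\mathbb M}\bigotimes_v\sigma(v)^{m(v)}$. Quantale of information, for finite $D$: $\mathrm{LoI}(D)$ is the set of equivalence relations on $D$ ordered by $P\sqsubseteq Q$ iff $Q\subseteq P$, so $P\sqcup Q=P\cap Q$; the least element $\mathrm{All}$ is the total relation. For $\mathbb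 P\subseteq\mathrm{LoI}(D)$, $\mathrm{mix}(\mathbb P)$ is the set of equivalence relations each of whose cells is a cell of some member of $\mathbb P$, and $\mathrm{tc}(\mathbb P)={\downarrow}\mathrm{mix}(\mathbb P)$. $\mathrm{QoI}(D)$ is the set of $\mathbb P$ with $\mathrm{tc}(\mathbb P)=\mathbb P$, ordered by inclusion, with $\bigvee_i\mathbb P_i=\mathrm{tc}(\bigcup_i\mathbb P_i)$, $\mathbb P\otimes\mathbb Q=\mathrm{tc}\{P\sqcup Q\mid P\in\mathbb P,Q\in\mathbb Q\}$, unit $\{\mathrm{All}\}$; it is a commutative complete quantale. *)

theory Defs
  imports "HOL-Library.FuncSet" "HOL-Library.Extended_Nat" "HOL-Library.Numeral_Type"
begin

section \<open>Commutative complete quantales\<close>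

text \<open>The tensor is \<open>*\<close>, its unit is \<open>1\<close>, so tensor powers and finite tensor products are
  the library's \<open>^\<close> and \<open>\<Prod>\<close>.\<close>

class comm_quantale = complete_lattice + comm_monoid_mult +
  assumes mult_Sup: "x * Sup A = (SUP a\<in>A. x * a)"

definition M1 :: "'m::comm_quantale set" where
  "M1 = {m. 1 \<le> m}"

text \<open>The value is \<open>\<infinity>\<close> when the powers of \<open>m\<close> never become stationary.\<close>

definition qorder :: "'m::comm_quantale \<Rightarrow> enat" where
  "qorder m = (if \<exists>k\<ge>1. m ^ k = m ^ (k + 1)
               then enat (LEAST k. k \<ge> 1 \<and> m ^ k = m ^ (k + 1)) else \<infinity>)"

text \<open>The set \<open>Var\<close> is an explicit (possibly empty) carrier, and \<open>\<nat>\<^sup>V\<^sup>a\<^sup>r\<close> is the set of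
  extensional functions on it.\<close>

definition U_nat :: "'v set \<Rightarrow> ('v \<Rightarrow> nat) set set" where
  "U_nat Var = {MM. MM \<subseteq> Var \<rightarrow>\<^sub>E UNIV \<and>
     (\<forall>m\<in>MM. \<forall>n \<in> Var \<rightarrow>\<^sub>E UNIV. (\<forall>v\<in>Var. n v \<le> m v) \<longrightarrow> n \<in> MM)}"

definition alpha_nat :: "'v set \<Rightarrow> ('v \<Rightarrow> 'm::comm_quantale) \<Rightarrow> ('v \<Rightarrow> nat) set \<Rightarrow> 'm" where
  "alpha_nat Var \<sigma> MM = (SUP m\<in>MM. \<Prod>v\<in>Var. \<sigma> v ^ m v)"


section \<open>The quantale of information\<close>

definition LoI :: "('d \<times> 'd) set set" where
  "LoI = {R. equiv UNIV R}"

definition loi_le :: "('d \<times> 'd) set \<Rightarrow> ('d \<times> 'd) set \<Rightarrow> bool" where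
  "loi_le P Q \<longleftrightarrow> Q \<subseteq> P"

definition loi_join :: "('d \<times> 'd) set \<Rightarrow> ('d \<times> 'd) set \<Rightarrow> ('d \<times> 'd) set" where
  "loi_join P Q = P \<inter> Q"

definition loi_All :: "('d \<times> 'd) set" where
  "loi_All = UNIV"

definition loi_down :: "('d \<times> 'd) set set \<Rightarrow> ('d \<times> 'd) set set" where
  "loi_down PP = {P \<in> LoI. \<exists>Q\<in>PP. loi_le P Q}"

definition mix :: "('d \<times> 'd) set set \<Rightarrow> ('d \<times> 'd) set set" where
  "mix PP = {R \<in> LoI. \<forall>C \<in> UNIV // R. \<exists>P\<in>PP. C \<in> UNIV // P}"

definition tc :: "('d \<times> 'd) set set \<Rightarrow> ('d \<times> 'd) set set" where
  "tc PP = loi_down (mix PP)"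

definition tensor :: "('d \<times> 'd) set set \<Rightarrow> ('d \<times> 'd) set set \<Rightarrow> ('d \<times> 'd) set set" where
  "tensor PP QQ = tc {loi_join P Q | P Q. P \<in> PP \<and> Q \<in> QQ}"

lemma LoI_classI: "\<lbrakk>R \<in> LoI; (x, y) \<in> R\<rbrakk> \<Longrightarrow> R `` {x} = R `` {y}"
  by (metis LoI_def equiv_class_eq mem_Collect_eq)

lemma LoI_refl: "R \<in> LoI \<Longrightarrow> (x, x) \<in> R"
  by (auto simp: LoI_def equiv_def refl_on_def)

lemma LoI_sym: "R \<in> LoI \<Longrightarrow> (x, y) \<in> R \<Longrightarrow> (y, x) \<in> R"
  by (auto simp: LoI_def equiv_def sym_def)

lemma LoI_trans: "R \<in> LoI \<Longrightarrow> (x, y) \<in> R \<Longrightarrow> (y, z) \<in> R \<Longrightarrow> (x, z) \<in> R"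
  unfolding LoI_def equiv_def trans_def by blast

lemma LoI_intro:
  assumes "\<And>x. (x, x) \<in> R" "\<And>x y. (x, y) \<in> R \<Longrightarrow> (y, x) \<in> R"
    "\<And>x y z. (x, y) \<in> R \<Longrightarrow> (y, z) \<in> R \<Longrightarrow> (x, z) \<in> R"
  shows "R \<in> LoI"
proof -
  have "equiv UNIV R"
  proof (rule equivI)
    show "R \<subseteq> UNIV \<times> UNIV" by simp
    show "refl R" by (rule refl_onI) (rule assms(1))
    show "sym R" by (rule symI) (rule assms(2))
    show "trans R" by (rule transI) (rule assms(3))
  qed
  then show ?thesis by (simp add: LoI_def)
qed

lemma LoI_Int: "P \<in> LoI \<Longrightarrow> Q \<in> LoI \<Longrightarrow> P \<inter> Q \<in> LoI"
  by (rule LoI_intro) (blast intro: LoI_refl, blast dest: LoI_sym, blast dest: LoI_trans)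

lemma Int_Image_single: "(P \<inter> Q) `` {x} = P `` {x} \<inter> Q `` {x}"
  by blast

lemma mem_mix_iff:
  assumes "PP \<subseteq> LoI"
  shows "R \<in> mix PP \<longleftrightarrow> R \<in> LoI \<and> (\<forall>x. \<exists>P\<in>PP. R `` {x} = P `` {x})"
proof
  assume R: "R \<in> mix PP"
  then have RL: "R \<in> LoI" by (simp add: mix_def)
  have "\<exists>P\<in>PP. R `` {x} = P `` {x}" for x
  proof -
    have "R `` {x} \<in> UNIV // R" by (rule quotientI) simp
    then obtain P where P: "P \<in> PP" "R `` {x} \<in> UNIV // P"
      using R by (auto simp: mix_def)
    from P(2) obtain z where z: "R `` {x} = P `` {z}" by (rule quotientE)
    have "(z, x) \<in> P" using z LoI_refl[OF RL] by blast
    then show ?thesis using z P LoI_classI assms by (metis subsetD)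
  qed
  then show "R \<in> LoI \<and> (\<forall>x. \<exists>P\<in>PP. R `` {x} = P `` {x})" using RL by blast
next
  assume *: "R \<in> LoI \<and> (\<forall>x. \<exists>P\<in>PP. R `` {x} = P `` {x})"
  have "\<exists>P\<in>PP. C \<in> UNIV // P" if C: "C \<in> UNIV // R" for C
  proof -
    obtain x where "C = R `` {x}" using C by (rule quotientE)
    then obtain P where "P \<in> PP" "C = P `` {x}" using * by metis
    then show ?thesis by (metis UNIV_I quotientI)
  qed
  then show "R \<in> mix PP" using * by (auto simp: mix_def)
qed

lemma mix_LoI: "mix PP \<subseteq> LoI"
  by (auto simp: mix_def)

lemma tc_LoI: "tc PP \<subseteq> LoI"
  by (auto simp: tc_def loi_down_def)

lemma mem_tc_iff: "P \<in> tc PP \<longleftrightarrow> P \<in> LoI \<and> (\<exists>Q\<in>mix PP. Q \<subseteq> P)"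
  by (auto simp: tc_def loi_down_def loi_le_def)

lemma tc_mono: "PP \<subseteq> QQ \<Longrightarrow> tc PP \<subseteq> tc QQ"
  unfolding tc_def loi_down_def mix_def by blast

lemma tc_ext: "PP \<subseteq> LoI \<Longrightarrow> PP \<subseteq> tc PP"
  unfolding mem_tc_iff[of _ PP] subset_iff[of PP "tc PP"]
  using mem_mix_iff[of PP] by blast

lemma tc_idem:
  assumes PP: "PP \<subseteq> LoI"
  shows "tc (tc PP) = tc PP"
proof
  show "tc PP \<subseteq> tc (tc PP)" by (rule tc_ext[OF tc_LoI])
  show "tc (tc PP) \<subseteq> tc PP"
  proof
    fix S assume "S \<in> tc (tc PP)"
    then obtain R where SL: "S \<in> LoI" and RS: "R \<subseteq> S" and R: "R \<in> mix (tc PP)"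
      by (auto simp: mem_tc_iff)
    have RL: "R \<in> LoI" using R mix_LoI by blast
    have "\<exists>Q'. Q' \<in> mix PP \<and> (\<forall>y\<in>C. Q' `` {y} \<subseteq> C)" if C: "C \<in> UNIV // R" for C
    proof -
      obtain x where x: "C = R `` {x}" using C by (rule quotientE)
      obtain Q where "Q \<in> tc PP" "R `` {x} = Q `` {x}"
        using R mem_mix_iff[OF tc_LoI] by metis
      then obtain Q' where Q': "Q' \<in> mix PP" "Q' \<subseteq> Q" and QL: "Q \<in> LoI"
        by (auto simp: mem_tc_iff)
      have "\<forall>y\<in>C. Q' `` {y} \<subseteq> C"
        using x \<open>R `` {x} = Q `` {x}\<close> Q' LoI_trans[OF QL] by blast
      then show ?thesis using Q' by blast
    qed
    then obtain f where f: "\<And>C. C \<in> UNIV // R \<Longrightarrow> f C \<in> mix PP"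
        "\<And>C y. C \<in> UNIV // R \<Longrightarrow> y \<in> C \<Longrightarrow> f C `` {y} \<subseteq> C"
      by metis
    have cell: "R `` {x} \<in> UNIV // R" for x by (rule quotientI) simp
    have fL: "f (R `` {x}) \<in> LoI" for x using f(1)[OF cell] mix_LoI by blast
    define T where "T = {(x, y). (x, y) \<in> f (R `` {x})}"
    have Tx: "T `` {x} = f (R `` {x}) `` {x}" for x by (auto simp: T_def)
    have TR: "T \<subseteq> R"
      using f(2)[OF cell] LoI_refl[OF RL] by (auto simp: T_def)
    have TL: "T \<in> LoI"
    proof (rule LoI_intro)
      show "(x, x) \<in> T" for x by (simp add: T_def LoI_refl[OF fL])
      show "(y, x) \<in> T" if "(x, y) \<in> T" for x y
      proof -
        have "R `` {x} = R `` {y}" using that TR LoI_classI[OF RL] by blast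
        then show ?thesis using that LoI_sym[OF fL] by (auto simp: T_def)
      qed
      show "(x, z) \<in> T" if "(x, y) \<in> T" "(y, z) \<in> T" for x y z
      proof -
        have "R `` {x} = R `` {y}" using that TR LoI_classI[OF RL] by blast
        then show ?thesis using that LoI_trans[OF fL] by (auto simp: T_def)
      qed
    qed
    have "\<exists>P\<in>PP. T `` {x} = P `` {x}" for x
      using f(1)[OF cell] mem_mix_iff[OF PP] Tx by metis
    then have "T \<in> mix PP" using TL mem_mix_iff[OF PP] by blast
    then show "S \<in> tc PP" using SL TR RS by (auto simp: mem_tc_iff)
  qed
qed

lemma tc_least: "\<lbrakk>PP \<subseteq> tc QQ; QQ \<subseteq> LoI\<rbrakk> \<Longrightarrow> tc PP \<subseteq> tc QQ"
  using tc_mono tc_idem by metis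

lemma tc_joins:
  assumes PP: "PP \<subseteq> LoI" and QQ: "QQ \<subseteq> LoI"
  shows "tensor (tc PP) (tc QQ) = tensor PP QQ"
proof
  let ?J = "{loi_join P Q | P Q. P \<in> PP \<and> Q \<in> QQ}"
  have J: "?J \<subseteq> LoI" using PP QQ LoI_Int unfolding loi_join_def by blast
  show "tensor PP QQ \<subseteq> tensor (tc PP) (tc QQ)"
    unfolding tensor_def using tc_ext[OF PP] tc_ext[OF QQ] by (intro tc_mono) blast
  show "tensor (tc PP) (tc QQ) \<subseteq> tensor PP QQ"
    unfolding tensor_def
  proof (rule tc_least[OF _ J], safe)
    fix P Q assume "P \<in> tc PP" "Q \<in> tc QQ"
    then obtain P' Q' where PL: "P \<in> LoI" and QL: "Q \<in> LoI"
      and P': "P' \<in> mix PP" "P' \<subseteq> P" and Q': "Q' \<in> mix QQ" "Q' \<subseteq> Q"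
      by (auto simp: mem_tc_iff)
    have L: "P' \<inter> Q' \<in> LoI" using P' Q' mix_LoI LoI_Int by blast
    have "\<exists>R\<in>?J. (P' \<inter> Q') `` {x} = R `` {x}" for x
    proof -
      obtain A where A: "A \<in> PP" "P' `` {x} = A `` {x}"
        using P'(1) mem_mix_iff[OF PP] by metis
      obtain B where B: "B \<in> QQ" "Q' `` {x} = B `` {x}"
        using Q'(1) mem_mix_iff[OF QQ] by metis
      have "(P' \<inter> Q') `` {x} = loi_join A B `` {x}"
        unfolding loi_join_def Int_Image_single A(2)[symmetric] B(2)[symmetric] by (rule refl)
      moreover have "loi_join A B \<in> ?J" using A(1) B(1) by blast
      ultimately show ?thesis by blast
    qed
    then have "P' \<inter> Q' \<in> mix ?J" unfolding mem_mix_iff[OF J] using L by simp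
    moreover have "P' \<inter> Q' \<subseteq> loi_join P Q"
      using P'(2) Q'(2) unfolding loi_join_def by blast
    moreover have "loi_join P Q \<in> LoI"
      using LoI_Int[OF PL QL] by (simp add: loi_join_def)
    ultimately show "loi_join P Q \<in> tc ?J"
      unfolding mem_tc_iff by (intro conjI bexI[of _ "P' \<inter> Q'"])
  qed
qed

typedef ('d::finite) qoi = "{PP :: ('d \<times> 'd) set set. PP \<subseteq> LoI \<and> tc PP = PP}"
  using tc_LoI tc_idem[of "{}"] by blast

definition qoi_tc :: "('d::finite \<times> 'd) set set \<Rightarrow> 'd qoi" where
  "qoi_tc PP = Abs_qoi (tc PP)"

lemma Rep_qoi_LoI: "Rep_qoi p \<subseteq> LoI"
  using Rep_qoi[of p] by blast

lemma tc_Rep_qoi: "tc (Rep_qoi p) = Rep_qoi p"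
  using Rep_qoi[of p] by blast

lemma Rep_qoi_tc: "PP \<subseteq> LoI \<Longrightarrow> Rep_qoi (qoi_tc PP) = tc PP"
  unfolding qoi_tc_def by (rule Abs_qoi_inverse) (auto simp: tc_idem tc_LoI[THEN subsetD])

lemma qoi_tc_le: "PP \<subseteq> Rep_qoi p \<Longrightarrow> tc PP \<subseteq> Rep_qoi p"
  using tc_mono tc_Rep_qoi by metis

lemma Rep_qoi_UN_LoI: "(\<Union>p\<in>A. Rep_qoi p) \<subseteq> LoI"
  using Rep_qoi_LoI by blast

lemma loi_join_LoI: "P \<in> LoI \<Longrightarrow> Q \<in> LoI \<Longrightarrow> loi_join P Q \<in> LoI"
  unfolding loi_join_def by (rule LoI_Int)

lemma loi_join_commute: "loi_join P Q = loi_join Q P"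
  unfolding loi_join_def by (rule Int_commute)

lemma loi_join_assoc: "loi_join (loi_join P Q) R = loi_join P (loi_join Q R)"
  unfolding loi_join_def by (rule Int_assoc)

lemma loi_join_All: "loi_join loi_All P = P"
  by (simp add: loi_join_def loi_All_def)

lemma joins_LoI: "PP \<subseteq> LoI \<Longrightarrow> QQ \<subseteq> LoI \<Longrightarrow> {loi_join P Q | P Q. P \<in> PP \<and> Q \<in> QQ} \<subseteq> LoI"
  using loi_join_LoI by blast

lemma joins_commute:
  "{loi_join P Q | P Q. P \<in> PP \<and> Q \<in> QQ} = {loi_join P Q | P Q. P \<in> QQ \<and> Q \<in> PP}"
proof -
  have "{loi_join P Q | P Q. P \<in> A \<and> Q \<in> B} \<subseteq> {loi_join P Q | P Q. P \<in> B \<and> Q \<in> A}"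
    for A B :: "('a \<times> 'a) set set"
  proof
    fix X assume "X \<in> {loi_join P Q | P Q. P \<in> A \<and> Q \<in> B}"
    then obtain P Q where PQ: "X = loi_join P Q" "P \<in> A" "Q \<in> B" by blast
    have "X = loi_join Q P" using PQ(1) loi_join_commute by (rule trans)
    then show "X \<in> {loi_join P Q | P Q. P \<in> B \<and> Q \<in> A}" using PQ(2,3) by blast
  qed
  then show ?thesis by (intro subset_antisym)
qed

lemma joins_assoc:
  "{loi_join P R | P R. P \<in> {loi_join P Q | P Q. P \<in> PP \<and> Q \<in> QQ} \<and> R \<in> RR} =
   {loi_join P R | P R. P \<in> PP \<and> R \<in> {loi_join Q R | Q R. Q \<in> QQ \<and> R \<in> RR}}"
  (is "?L = ?R")
proof -
  have "?L = {loi_join (loi_join P Q) R | P Q R. P \<in> PP \<and> Q \<in> QQ \<and> R \<in> RR}"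
    by blast
  also have "\<dots> = {loi_join P (loi_join Q R) | P Q R. P \<in> PP \<and> Q \<in> QQ \<and> R \<in> RR}"
    by (simp only: loi_join_assoc)
  also have "\<dots> = ?R"
    by blast
  finally show ?thesis .
qed

instantiation qoi :: (finite) comm_quantale
begin

definition "less_eq_qoi p q \<longleftrightarrow> Rep_qoi p \<subseteq> Rep_qoi q"
definition "less_qoi p q \<longleftrightarrow> Rep_qoi p \<subset> Rep_qoi q"
definition "Sup_qoi A = qoi_tc (\<Union>p\<in>A. Rep_qoi p)"
definition "Inf_qoi A = qoi_tc (LoI \<inter> (\<Inter>p\<in>A. Rep_qoi p))"
definition "sup_qoi p q = qoi_tc (Rep_qoi p \<union> Rep_qoi q)"
definition "inf_qoi p q = qoi_tc (Rep_qoi p \<inter> Rep_qoi q)"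
definition "bot_qoi = qoi_tc ({} :: ('a \<times> 'a) set set)"
definition "top_qoi = qoi_tc (LoI :: ('a \<times> 'a) set set)"
definition "one_qoi = qoi_tc {loi_All :: ('a \<times> 'a) set}"
definition "times_qoi p q = Abs_qoi (tensor (Rep_qoi p) (Rep_qoi q))"

lemma Rep_times_qoi: "Rep_qoi (p * q) = tensor (Rep_qoi p) (Rep_qoi q)"
  using Rep_qoi_tc[OF joins_LoI[OF Rep_qoi_LoI Rep_qoi_LoI]]
  by (simp add: times_qoi_def tensor_def qoi_tc_def)

lemma Rep_Sup_qoi: "Rep_qoi (Sup A) = tc (\<Union>p\<in>A. Rep_qoi p)"
  by (simp add: Sup_qoi_def Rep_qoi_tc Rep_qoi_UN_LoI)

lemma Rep_one_qoi: "Rep_qoi (1 :: 'a qoi) = {loi_All}"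
proof -
  have L: "{loi_All :: ('a \<times> 'a) set} \<subseteq> LoI"
    by (auto simp: loi_All_def intro: LoI_intro)
  have "tc {loi_All :: ('a \<times> 'a) set} \<subseteq> {loi_All}"
  proof
    fix P :: "('a \<times> 'a) set" assume "P \<in> tc {loi_All}"
    then obtain Q where "Q \<in> mix {loi_All}" "Q \<subseteq> P" by (auto simp: mem_tc_iff)
    then have "\<forall>x. Q `` {x} = UNIV"
      unfolding mem_mix_iff[OF L] by (simp add: loi_All_def Image_def)
    then have "Q = UNIV" by (metis Image_singleton_iff UNIV_I UNIV_eq_I surj_pair)
    then show "P \<in> {loi_All}" using \<open>Q \<subseteq> P\<close> by (auto simp: loi_All_def)
  qed
  then show ?thesis using tc_ext[OF L] Rep_qoi_tc[OF L] by (auto simp: one_qoi_def)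
qed

instance
proof
  fix p q r :: "'a qoi" and A :: "'a qoi set"
  show "(p < q) = (p \<le> q \<and> \<not> q \<le> p)"
    by (auto simp: less_eq_qoi_def less_qoi_def)
  show "p \<le> p" by (simp add: less_eq_qoi_def)
  show "p \<le> q \<Longrightarrow> q \<le> r \<Longrightarrow> p \<le> r" by (auto simp: less_eq_qoi_def)
  show "p \<le> q \<Longrightarrow> q \<le> p \<Longrightarrow> p = q"
    by (simp add: less_eq_qoi_def Rep_qoi_inject[symmetric] subset_antisym)
  have inf: "Rep_qoi (inf p q) = tc (Rep_qoi p \<inter> Rep_qoi q)" for p q :: "'a qoi"
    unfolding inf_qoi_def using Rep_qoi_LoI by (intro Rep_qoi_tc) blast
  show "inf p q \<le> p" "inf p q \<le> q"
    unfolding less_eq_qoi_def inf by (rule qoi_tc_le; blast)+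
  have infext: "Rep_qoi q \<inter> Rep_qoi r \<subseteq> tc (Rep_qoi q \<inter> Rep_qoi r)"
    using Rep_qoi_LoI by (intro tc_ext) blast
  show "p \<le> q \<Longrightarrow> p \<le> r \<Longrightarrow> p \<le> inf q r"
    unfolding less_eq_qoi_def inf using infext by blast
  have sup: "Rep_qoi (sup p q) = tc (Rep_qoi p \<union> Rep_qoi q)" for p q :: "'a qoi"
    unfolding sup_qoi_def using Rep_qoi_LoI by (intro Rep_qoi_tc) blast
  have supext: "Rep_qoi p \<union> Rep_qoi q \<subseteq> tc (Rep_qoi p \<union> Rep_qoi q)" for p q :: "'a qoi"
    using Rep_qoi_LoI by (intro tc_ext) blast
  show "p \<le> sup p q" unfolding less_eq_qoi_def sup using supext by blast
  show "q \<le> sup p q" unfolding less_eq_qoi_def sup using supext by blast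
  show "q \<le> p \<Longrightarrow> r \<le> p \<Longrightarrow> sup q r \<le> p"
    unfolding less_eq_qoi_def sup by (rule qoi_tc_le) blast
  have Inf: "Rep_qoi (Inf A) = tc (LoI \<inter> (\<Inter>p\<in>A. Rep_qoi p))" for A :: "'a qoi set"
    unfolding Inf_qoi_def by (intro Rep_qoi_tc) blast
  show "p \<in> A \<Longrightarrow> Inf A \<le> p"
    unfolding less_eq_qoi_def Inf by (rule qoi_tc_le) blast
  have Infext: "LoI \<inter> (\<Inter>p\<in>A. Rep_qoi p) \<subseteq> tc (LoI \<inter> (\<Inter>p\<in>A. Rep_qoi p))"
    by (intro tc_ext) blast
  show "(\<And>q. q \<in> A \<Longrightarrow> p \<le> q) \<Longrightarrow> p \<le> Inf A"
    unfolding less_eq_qoi_def Inf using Infext Rep_qoi_LoI[of p] by blast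
  show "p \<in> A \<Longrightarrow> p \<le> Sup A"
    unfolding less_eq_qoi_def Rep_Sup_qoi using tc_ext[OF Rep_qoi_UN_LoI] by blast
  show "(\<And>q. q \<in> A \<Longrightarrow> q \<le> p) \<Longrightarrow> Sup A \<le> p"
    unfolding less_eq_qoi_def Rep_Sup_qoi by (rule qoi_tc_le) blast
  show "Inf ({} :: 'a qoi set) = top" by (simp add: Inf_qoi_def top_qoi_def)
  show "Sup ({} :: 'a qoi set) = bot" by (simp add: Sup_qoi_def bot_qoi_def)
  show "p * q = q * p"
    unfolding Rep_qoi_inject[symmetric] Rep_times_qoi tensor_def
    by (rule arg_cong[of _ _ tc], rule joins_commute)
  show "p * q * r = p * (q * r)"
  proof -
    let ?J = "\<lambda>PP QQ :: ('a \<times> 'a) set set. {loi_join P Q | P Q. P \<in> PP \<and> Q \<in> QQ}"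
    let ?p = "Rep_qoi p" and ?q = "Rep_qoi q" and ?r = "Rep_qoi r"
    have L: "?p \<subseteq> LoI" "?q \<subseteq> LoI" "?r \<subseteq> LoI" by (rule Rep_qoi_LoI)+
    have "Rep_qoi (p * q * r) = tensor (tc (?J ?p ?q)) (tc ?r)"
      by (simp add: Rep_times_qoi tc_Rep_qoi tensor_def[of ?p ?q])
    also have "\<dots> = tensor (?J ?p ?q) ?r"
      by (rule tc_joins[OF joins_LoI[OF L(1,2)] L(3)])
    also have "\<dots> = tensor ?p (?J ?q ?r)"
      unfolding tensor_def by (rule arg_cong[of _ _ tc], rule joins_assoc)
    also have "\<dots> = tensor (tc ?p) (tc (?J ?q ?r))"
      by (rule tc_joins[OF L(1) joins_LoI[OF L(2,3)], symmetric])
    also have "\<dots> = Rep_qoi (p * (q * r))"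
      by (simp add: Rep_times_qoi tc_Rep_qoi tensor_def[of ?q ?r])
    finally show ?thesis by (simp add: Rep_qoi_inject)
  qed
  show "1 * p = p"
  proof -
    have "{loi_join P Q | P Q. P \<in> {loi_All} \<and> Q \<in> Rep_qoi p} = Rep_qoi p"
      by (simp add: loi_join_All)
    then have "Rep_qoi (1 * p) = Rep_qoi p"
      by (simp add: Rep_times_qoi Rep_one_qoi tensor_def tc_Rep_qoi)
    then show ?thesis by (simp add: Rep_qoi_inject)
  qed
  show "p * Sup A = (SUP a\<in>A. p * a)"
  proof -
    let ?J = "\<lambda>PP QQ :: ('a \<times> 'a) set set. {loi_join P Q | P Q. P \<in> PP \<and> Q \<in> QQ}"
    let ?U = "\<Union>a\<in>A. Rep_qoi a"
    have "Rep_qoi (p * Sup A) = tensor (tc (Rep_qoi p)) (tc ?U)"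
      by (simp add: Rep_times_qoi Rep_Sup_qoi tc_Rep_qoi)
    also have "\<dots> = tensor (Rep_qoi p) ?U"
      by (rule tc_joins[OF Rep_qoi_LoI Rep_qoi_UN_LoI])
    also have "\<dots> = tc (\<Union>a\<in>A. ?J (Rep_qoi p) (Rep_qoi a))"
      unfolding tensor_def by (rule arg_cong[of _ _ tc]) blast
    also have "\<dots> = tc (\<Union>a\<in>A. tc (?J (Rep_qoi p) (Rep_qoi a)))"
    proof
      have J: "?J (Rep_qoi p) (Rep_qoi a) \<subseteq> LoI" for a
        by (rule joins_LoI[OF Rep_qoi_LoI Rep_qoi_LoI])
      show "tc (\<Union>a\<in>A. ?J (Rep_qoi p) (Rep_qoi a)) \<subseteq> tc (\<Union>a\<in>A. tc (?J (Rep_qoi p) (Rep_qoi a)))"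
        by (rule tc_mono) (rule UN_mono[OF subset_refl tc_ext[OF J]])
      show "tc (\<Union>a\<in>A. tc (?J (Rep_qoi p) (Rep_qoi a))) \<subseteq> tc (\<Union>a\<in>A. ?J (Rep_qoi p) (Rep_qoi a))"
        by (rule tc_least[OF UN_least UN_least[OF J]], rule tc_mono, blast)
    qed
    also have "\<dots> = Rep_qoi (SUP a\<in>A. p * a)"
      by (simp add: Rep_Sup_qoi Rep_times_qoi tensor_def)
    finally show ?thesis by (simp add: Rep_qoi_inject)
  qed
qed

end

definition ker_rel :: "('d \<Rightarrow> 'e) \<Rightarrow> ('d \<times> 'd) set" where
  "ker_rel f = {(x, y). f x = f y}"

text \<open>The set \<open>{0, 1}\<close> is the numeral type \<open>2\<close>, whose elements are exactly \<open>0\<close> and \<open>1\<close>.\<close>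

definition SS :: "(2 \<times> 2) qoi" where
  "SS = qoi_tc {ker_rel fst, ker_rel snd}"

end

theory Submission
  imports Defs
begin

text \<open>Once \<open>m ^ k = m ^ (k + 1)\<close> the powers of \<open>m\<close> are constant from \<open>k\<close> on, so the two joins agree
  term by term. In the example, \<open>\<sim>\<^sub>1 \<inter> \<sim>\<^sub>2\<close> is the identity relation, whose presence forces an element
  of the quantale of information to be \<open>\<top>\<close>; but the cells of \<open>\<sim>\<^sub>1\<close> and \<open>\<sim>\<^sub>2\<close> are not singletons, so
  the identity is not in \<open>\<SS>\<close> itself.\<close>

lemma power_stationary:
  fixes m :: "'m::monoid_mult"
  assumes "m ^ k = m ^ (k + 1)" "k \<le> n"
  shows "m ^ n = m ^ k"
  using assms(2)
proof (induction n rule: dec_induct)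
  case (step n)
  have "m ^ Suc n = m * m ^ k" unfolding power_Suc step.IH by (rule refl)
  also have "\<dots> = m ^ (k + 1)" by simp
  also have "\<dots> = m ^ k" by (rule assms(1)[symmetric])
  finally show ?case .
qed simp

text \<open>The minimum with \<open>enat n\<close> is finite, so \<open>the_enat\<close> is always
  applied to a genuine number. With infinite order the minimum is \<open>n\<close>; with order
  \<open>k\<close> only the case \<open>n > k\<close> changes the exponent, and there both powers
  lie in the stationary range.\<close>

lemma power_min_qorder:
  fixes m :: "'m::comm_quantale"
  shows "m ^ the_enat (min (enat n) (qorder m)) = m ^ n"
proof (cases "\<exists>k\<ge>1. m ^ k = m ^ (k + 1)")
  case True
  define k where "k = (LEAST k. k \<ge> 1 \<and> m ^ k = m ^ (k + 1))"
  have "k \<ge> 1 \<and> m ^ k = m ^ (k + 1)"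
    unfolding k_def by (rule LeastI_ex) (use True in blast)
  then have k: "m ^ k = m ^ (k + 1)" by blast
  have "qorder m = enat k" using True by (simp add: qorder_def k_def)
  then have "the_enat (min (enat n) (qorder m)) = min n k" by simp
  moreover have "m ^ min n k = m ^ n"
    using power_stationary[OF k, of n] by (cases "n \<le> k") auto
  ultimately show ?thesis by simp
next
  case False
  then have "qorder m = \<infinity>" unfolding qorder_def by (rule if_not_P)
  then show ?thesis by simp
qed

lemma Id_LoI: "Id \<in> LoI"
  by (rule LoI_intro) auto

lemma ker_rel_LoI: "ker_rel f \<in> LoI"
  by (rule LoI_intro) (auto simp: ker_rel_def)

text \<open>By reflexivity, an equivalence relation inside \<open>Id\<close> equals
  \<open>Id\<close>. The downward closure therefore cannot add \<open>Id\<close>, and membership is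
  decided by \<open>mix\<close>, cell by cell.\<close>

lemma Id_mem_tc_iff:
  assumes "PP \<subseteq> LoI"
  shows "Id \<in> tc PP \<longleftrightarrow> (\<forall>x. \<exists>P\<in>PP. P `` {x} = {x})"
proof -
  have "Q = Id" if "Q \<in> mix PP" "Q \<subseteq> Id" for Q
  proof -
    have "Q \<in> LoI" using that(1) mix_LoI by blast
    then show ?thesis using that(2) LoI_refl by fastforce
  qed
  then have "Id \<in> tc PP \<longleftrightarrow> Id \<in> mix PP"
    using Id_LoI by (auto simp: mem_tc_iff)
  also have "\<dots> \<longleftrightarrow> (\<forall>x. \<exists>P\<in>PP. P `` {x} = {x})"
    using mem_mix_iff[OF assms] Id_LoI by (metis Image_Id)
  finally show ?thesis .
qed

text \<open>\<open>Id\<close> is the finest equivalence relation, hence the greatest element of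
  \<open>LoI\<close>, and a closed set is a downset.\<close>

lemma qoi_eq_top_iff: "p = top \<longleftrightarrow> Id \<in> Rep_qoi p"
proof
  have "LoI \<subseteq> Rep_qoi (top :: 'a qoi)"
    unfolding top_qoi_def Rep_qoi_tc[OF subset_refl] by (rule tc_ext) simp
  then show "Id \<in> Rep_qoi p" if "p = top" using that Id_LoI by blast
next
  assume Id: "Id \<in> Rep_qoi p"
  have "LoI \<subseteq> Rep_qoi p"
  proof
    fix P :: "('a \<times> 'a) set" assume P: "P \<in> LoI"
    have "Id \<in> tc (Rep_qoi p)" using Id tc_Rep_qoi by blast
    then obtain Q where Q: "Q \<in> mix (Rep_qoi p)" "Q \<subseteq> Id" by (auto simp: mem_tc_iff)
    have "Id \<subseteq> P" using LoI_refl[OF P] by auto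
    then have "P \<in> tc (Rep_qoi p)" using P Q by (auto simp: mem_tc_iff)
    then show "P \<in> Rep_qoi p" by (simp add: tc_Rep_qoi)
  qed
  then have "top \<le> p"
    unfolding less_eq_qoi_def top_qoi_def Rep_qoi_tc[OF subset_refl] by (rule qoi_tc_le)
  then show "p = top" by (rule top_le)
qed

lemma join_mem_times_qoi:
  assumes "P \<in> Rep_qoi p" "Q \<in> Rep_qoi q"
  shows "P \<inter> Q \<in> Rep_qoi (p * q)"
proof -
  have "P \<inter> Q \<in> {loi_join P Q | P Q. P \<in> Rep_qoi p \<and> Q \<in> Rep_qoi q}"
    using assms unfolding loi_join_def by blast
  then show ?thesis
    unfolding Rep_times_qoi tensor_def
    using tc_ext[OF joins_LoI[OF Rep_qoi_LoI Rep_qoi_LoI]] by blast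
qed

lemma Rep_SS: "Rep_qoi SS = tc {ker_rel fst, ker_rel snd}"
  unfolding SS_def by (rule Rep_qoi_tc) (simp add: ker_rel_LoI)

lemma ker_rel_mem_SS: "ker_rel fst \<in> Rep_qoi SS" "ker_rel snd \<in> Rep_qoi SS"
  using tc_ext[of "{ker_rel fst, ker_rel snd :: ((2 \<times> 2) \<times> (2 \<times> 2)) set}"]
  by (simp_all add: Rep_SS ker_rel_LoI)

lemma SS_square: "SS * SS = top"
proof -
  have "ker_rel fst \<inter> ker_rel snd = (Id :: ((2 \<times> 2) \<times> (2 \<times> 2)) set)"
    by (auto simp: ker_rel_def)
  then show ?thesis
    using join_mem_times_qoi[OF ker_rel_mem_SS] by (simp add: qoi_eq_top_iff)
qed

lemma SS_cube: "SS * (SS * SS) = top"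
proof -
  have "Id \<in> Rep_qoi (SS * SS)" using SS_square qoi_eq_top_iff by blast
  \<comment> \<open>Any equivalence relation joined with \<open>Id\<close> is \<open>Id\<close>
    again, so the further factor \<open>SS\<close> keeps the product at the top.\<close>
  then have "ker_rel fst \<inter> Id \<in> Rep_qoi (SS * (SS * SS))"
    by (rule join_mem_times_qoi[OF ker_rel_mem_SS(1)])
  moreover have "ker_rel fst \<inter> Id = (Id :: ((2 \<times> 2) \<times> (2 \<times> 2)) set)"
    by (auto simp: ker_rel_def)
  ultimately show ?thesis by (simp add: qoi_eq_top_iff)
qed

lemma SS_neq_top: "SS \<noteq> top"
proof
  assume "SS = top"
  \<comment> \<open>Any point would serve as a test point: its cell under either kernel has two
    elements.\<close>
  then have "\<exists>P\<in>{ker_rel fst, ker_rel snd}. P `` {(0, 0)} = {(0 :: 2, 0 :: 2)}"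
    unfolding qoi_eq_top_iff Rep_SS
    by (subst (asm) Id_mem_tc_iff) (simp_all add: ker_rel_LoI)
  moreover have "ker_rel fst `` {(0, 0)} \<noteq> {(0 :: 2, 0 :: 2)}"
  proof -
    have "(0, 1) \<in> ker_rel fst `` {(0 :: 2, 0 :: 2)}" by (simp add: ker_rel_def)
    then show ?thesis by (metis Pair_inject singletonD zero_neq_one)
  qed
  moreover have "ker_rel snd `` {(0, 0)} \<noteq> {(0 :: 2, 0 :: 2)}"
  proof -
    have "(1, 0) \<in> ker_rel snd `` {(0 :: 2, 0 :: 2)}" by (simp add: ker_rel_def)
    then show ?thesis by (metis Pair_inject singletonD zero_neq_one)
  qed
  ultimately show False by simp
qed

theorem proposition5:
  shows "(\<forall>(Var :: 'v set) (\<sigma> :: 'v \<Rightarrow> 'm::comm_quantale).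
            finite Var \<and> \<sigma> \<in> Var \<rightarrow> M1 \<longrightarrow>
            (\<forall>MM \<in> U_nat Var. alpha_nat Var \<sigma> MM =
               (SUP m\<in>MM. \<Prod>v\<in>Var. \<sigma> v ^ the_enat (min (enat (m v)) (qorder (\<sigma> v))))))
         \<and> (SS ^ 2 = top \<and> top = SS ^ 3 \<and> qorder SS = 2)"
proof -
  have sq: "SS ^ 2 = top" by (simp add: power2_eq_square SS_square)
  have cube: "SS ^ 3 = top" by (simp add: eval_nat_numeral SS_cube)
  have "(LEAST k. k \<ge> 1 \<and> SS ^ k = SS ^ (k + 1)) = 2"
  proof (rule Least_equality)
    show "2 \<ge> (1 :: nat) \<and> SS ^ 2 = SS ^ (2 + 1)" using sq cube by simp
  next
    fix k :: nat assume k: "k \<ge> 1 \<and> SS ^ k = SS ^ (k + 1)"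
    \<comment> \<open>Stationarity at exponent 1 would give
      \<open>SS = SS * SS = top\<close>.\<close>
    have "k \<noteq> 1"
    proof
      assume "k = 1"
      then have "SS ^ 1 = SS ^ (1 + 1)" using k by blast
      then show False using SS_square SS_neq_top by simp
    qed
    then show "2 \<le> k" using k by simp
  qed
  \<comment> \<open>A stationary exponent selects the finite branch of \<open>qorder\<close>, whose
    value is the least exponent just found.\<close>
  moreover have "\<exists>k\<ge>1. SS ^ k = SS ^ (k + 1)"
    by (rule exI[of _ 2]) (use sq cube in simp)
  ultimately have "qorder SS = 2" by (simp add: qorder_def numeral_eq_enat)
  then show ?thesis using sq cube by (simp add: alpha_nat_def power_min_qorder)
qed

end
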